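(* Let $R$ be a ring. Then either: (1) $R$ is a $1$-Peirce ring; (2) $R$ is an $n$-Peirce ring for some $n>1$, and for each $k\in\mathbb{Z}^+$ with $1<k\leq n$ there exists a complete set of orthogonal idempotents $\{e_i\}_{i=1}^k$ such that $R^\pi\in\mathcal{T}_k$; or (3) for each integer $k$ with $k>1$, there exists a complete set of orthogonal idempotents $\{e_i\}_{i=1}^k$ such that $R^\pi\in\mathcal{T}_k$.
   Context: All rings are associative with unity. A complete set of orthogonal idempotents is a set of pairwise orthogonal idempotents with sum $1$. An idempotent $e\in R$ is Peirce trivial if $eR(1-e)Re=0$ and $(1-e)ReR(1-e)=0$; $\mathfrak{P}_{\rm t}(R)$ is the set of Peirce trivial idempotents of $R$. A ring $R$ is a $1$-Peirce ring if $\mathfrak{P}_{\rm t}(R)=\{0,1\}$ with $0\neq1$. Inductively, for $n>1$, $R$ is an $n$-Peirce ring if there is $e\in\mathfrak{P}_{\rm t}(R)$ such that $eRe$ is an $m$-Peirce ring for some $1\leq m<n$ and $(1-e)R(1-e)$ is an $(n-m)$-Peirce ring. For a complete set of orthogonal idempotents $\{e_i\}_{i=1}^k$, $R^\pi$ is the $k$-by-$k$ generalized matrix ring with $(i,j)$-position $e_iRe_j$ and row-column multiplication induced by $R$; $R^\pi\in\mathcal{T}_k$ ($k>1$) means that the product maps $e_iRe_j\otimes_{e_jRe_j}e_jRe_i\to e_iRe_i$ are zero for all $i\neq j$. $\mathbb{Z}^+$ is the set of positive integers. *)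

theory Defs
  imports "HOL-Algebra.Ring"
begin

definition Peirce_pos :: "('a, 'm) ring_scheme \<Rightarrow> 'a \<Rightarrow> 'a \<Rightarrow> 'a set" where
  "Peirce_pos R e f = {e \<otimes>\<^bsub>R\<^esub> r \<otimes>\<^bsub>R\<^esub> f | r. r \<in> carrier R}"

definition corner_ring :: "('a, 'm) ring_scheme \<Rightarrow> 'a \<Rightarrow> ('a, 'm) ring_scheme" where
  "corner_ring R e = R\<lparr>carrier := Peirce_pos R e e, one := e\<rparr>"

text \<open>The additive subgroup \<open>eR(1-e)Re\<close> is generated by the products
  \<open>e r (1-e) s e\<close>, so it is zero iff all of these products are zero.\<close>

definition Peirce_trivial_idems :: "('a, 'm) ring_scheme \<Rightarrow> 'a set" where
  "Peirce_trivial_idems R = {e \<in> carrier R. e \<otimes>\<^bsub>R\<^esub> e = e \<and>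
     (\<forall>r\<in>carrier R. \<forall>s\<in>carrier R.
        e \<otimes>\<^bsub>R\<^esub> r \<otimes>\<^bsub>R\<^esub> (\<one>\<^bsub>R\<^esub> \<ominus>\<^bsub>R\<^esub> e) \<otimes>\<^bsub>R\<^esub> s \<otimes>\<^bsub>R\<^esub> e = \<zero>\<^bsub>R\<^esub>) \<and>
     (\<forall>r\<in>carrier R. \<forall>s\<in>carrier R.
        (\<one>\<^bsub>R\<^esub> \<ominus>\<^bsub>R\<^esub> e) \<otimes>\<^bsub>R\<^esub> r \<otimes>\<^bsub>R\<^esub> e \<otimes>\<^bsub>R\<^esub> s \<otimes>\<^bsub>R\<^esub> (\<one>\<^bsub>R\<^esub> \<ominus>\<^bsub>R\<^esub> e) = \<zero>\<^bsub>R\<^esub>)}"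

inductive n_Peirce_ring :: "nat \<Rightarrow> ('a, 'm) ring_scheme \<Rightarrow> bool" where
  one_Peirce: "Peirce_trivial_idems R = {\<zero>\<^bsub>R\<^esub>, \<one>\<^bsub>R\<^esub>} \<Longrightarrow> \<zero>\<^bsub>R\<^esub> \<noteq> \<one>\<^bsub>R\<^esub> \<Longrightarrow> n_Peirce_ring 1 R"
| split_Peirce: "1 < n \<Longrightarrow> e \<in> Peirce_trivial_idems R \<Longrightarrow> 1 \<le> m \<Longrightarrow> m < n \<Longrightarrow>
    n_Peirce_ring m (corner_ring R e) \<Longrightarrow>
    n_Peirce_ring (n - m) (corner_ring R (\<one>\<^bsub>R\<^esub> \<ominus>\<^bsub>R\<^esub> e)) \<Longrightarrow> n_Peirce_ring n R"

text \<open>The idempotents are indexed by \<open>{1..k}\<close> and required to be nonzero, hence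
  pairwise distinct: if zero members were allowed, the family \<open>1, 0, \<dots>, 0\<close> would be
  available in every ring for every \<open>k\<close>. The zero ring has no nonzero element, and there
  the constant family \<open>0\<close> is admitted.\<close>

definition complete_orth_idems :: "('a, 'm) ring_scheme \<Rightarrow> nat \<Rightarrow> (nat \<Rightarrow> 'a) \<Rightarrow> bool" where
  "complete_orth_idems R k e \<longleftrightarrow>
     (\<forall>i\<in>{1..k}. e i \<in> carrier R \<and> e i \<otimes>\<^bsub>R\<^esub> e i = e i) \<and>
     (\<forall>i\<in>{1..k}. \<forall>j\<in>{1..k}. i \<noteq> j \<longrightarrow> e i \<otimes>\<^bsub>R\<^esub> e j = \<zero>\<^bsub>R\<^esub>) \<and>
     (\<Oplus>\<^bsub>R\<^esub>i\<in>{1..k}. e i) = \<one>\<^bsub>R\<^esub> \<and>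
     (\<one>\<^bsub>R\<^esub> \<noteq> \<zero>\<^bsub>R\<^esub> \<longrightarrow> (\<forall>i\<in>{1..k}. e i \<noteq> \<zero>\<^bsub>R\<^esub>))"

text \<open>A generalized matrix ring, carrying along its positions \<open>M\<^sub>i\<^sub>j\<close> and
  the product maps \<open>pos_mult i j l\<close> from \<open>M\<^sub>i\<^sub>j \<times> M\<^sub>j\<^sub>l\<close>
  to \<open>M\<^sub>i\<^sub>l\<close>.\<close>

record 'a gen_matrix_ring = "(nat \<Rightarrow> nat \<Rightarrow> 'a) ring" +
  pos :: "nat \<Rightarrow> nat \<Rightarrow> 'a set"
  pos_mult :: "nat \<Rightarrow> nat \<Rightarrow> nat \<Rightarrow> 'a \<Rightarrow> 'a \<Rightarrow> 'a"

text \<open>The ring \<open>R\<^sup>\<pi>\<close>. Matrices are functions that vanish outside \<open>{1..k} \<times> {1..k}\<close>.\<close>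

definition Peirce_matrix_ring ::
    "('a, 'm) ring_scheme \<Rightarrow> nat \<Rightarrow> (nat \<Rightarrow> 'a) \<Rightarrow> 'a gen_matrix_ring" where
  "Peirce_matrix_ring R k e =
    \<lparr>carrier = {A. \<forall>i j. A i j \<in>
        (if i \<in> {1..k} \<and> j \<in> {1..k} then Peirce_pos R (e i) (e j) else {\<zero>\<^bsub>R\<^esub>})},
     mult = (\<lambda>A B i j. \<Oplus>\<^bsub>R\<^esub>l\<in>{1..k}. A i l \<otimes>\<^bsub>R\<^esub> B l j),
     one = (\<lambda>i j. if i \<in> {1..k} \<and> i = j then e i else \<zero>\<^bsub>R\<^esub>),
     zero = (\<lambda>i j. \<zero>\<^bsub>R\<^esub>),
     add = (\<lambda>A B i j. A i j \<oplus>\<^bsub>R\<^esub> B i j),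
     pos = (\<lambda>i j. Peirce_pos R (e i) (e j)),
     pos_mult = (\<lambda>i j l x y. x \<otimes>\<^bsub>R\<^esub> y)\<rparr>"

text \<open>A map on the tensor product \<open>M\<^sub>i\<^sub>j \<otimes> M\<^sub>j\<^sub>i\<close> is zero iff it vanishes on pure
  tensors.\<close>

definition trivial_product_rings :: "nat \<Rightarrow> 'a gen_matrix_ring set" ("\<T>") where
  "\<T> k = {S. 1 < k \<and> (\<forall>i\<in>{1..k}. \<forall>j\<in>{1..k}. i \<noteq> j \<longrightarrow>
     (\<forall>x\<in>pos S i j. \<forall>y\<in>pos S j i. pos_mult S i j i x y = \<zero>\<^bsub>S\<^esub> i i))}"

end

theory Submission
  imports Defs
begin

text \<open>A Peirce trivial idempotent \<open>e\<close> splits \<open>R\<close> into the corners \<open>eRe\<close> and \<open>(1-e)R(1-e)\<close> such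
  that every product leading from one corner to the other and back vanishes. Call a complete set
  \<open>E\<close> of nonzero orthogonal idempotents a trivial decomposition if \<open>xRyRx = 0\<close> for distinct
  \<open>x, y \<in> E\<close>; an enumeration of such an \<open>E\<close> with \<open>k > 1\<close> elements is what puts \<open>R\<^sup>\<pi>\<close> into \<open>\<T> k\<close>.
  The whole proof rests on one gluing principle (\<open>trivial_decomposition_Un\<close>): trivial
  decompositions of the two corners unite to one of \<open>R\<close>. Products that stay inside a corner vanish
  by hypothesis on that corner, and those that cross vanish because \<open>e\<close> is Peirce trivial.

  If \<open>R\<close> is an \<open>n\<close>-Peirce ring, gluing along the recursive definition gives decompositions of
  every size from \<open>1\<close> to \<open>n\<close> (\<open>n_Peirce_trivial_decomposition\<close>). If \<open>R \<noteq> 0\<close> is not an \<open>n\<close>-Peirce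
  ring for any \<open>n\<close>, then \<open>R\<close> has a Peirce trivial idempotent other than \<open>0\<close> and \<open>1\<close>, and one of its
  two corners is again of this kind, since otherwise the corners would make \<open>R\<close> an \<open>n\<close>-Peirce ring.
  Descending into that corner and keeping the complementary idempotent whole yields one more
  idempotent at each step, so decompositions of every size exist
  (\<open>non_Peirce_trivial_decomposition\<close>). The zero ring, which is not an \<open>n\<close>-Peirce ring either, has
  no nonzero idempotents; there the constant family \<open>0\<close> serves for every \<open>k\<close>.\<close>

section \<open>Corner rings\<close>

context ring
begin

lemma carrier_corner_ring:
  assumes e: "e \<in> carrier R" "e \<otimes> e = e"
  shows "carrier (corner_ring R e) = {x \<in> carrier R. e \<otimes> x = x \<and> x \<otimes> e = x}"
proof -
  have 1: "e \<otimes> (e \<otimes> r \<otimes> e) = e \<otimes> r \<otimes> e" "e \<otimes> r \<otimes> e \<otimes> e = e \<otimes> r \<otimes> e" if "r \<in> carrier R" for r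
    using e that by (simp_all add: m_assoc[symmetric]) (simp add: m_assoc)
  show ?thesis
    using e 1 by (force simp: corner_ring_def Peirce_pos_def)
qed

lemma corner_ring_simps [simp]:
  "one (corner_ring R e) = e" "mult (corner_ring R e) = mult R"
  "zero (corner_ring R e) = zero R" "add (corner_ring R e) = add R"
  by (simp_all add: corner_ring_def)

lemma ring_corner_ring:
  assumes e: "e \<in> carrier R" "e \<otimes> e = e"
  shows "ring (corner_ring R e)"
proof (rule ringI)
  show "abelian_group (corner_ring R e)"
  proof (rule abelian_groupI)
    fix x assume "x \<in> carrier (corner_ring R e)"
    then have "\<ominus> x \<in> carrier (corner_ring R e)" "\<ominus> x \<oplus> x = \<zero>"
      using e by (auto simp: carrier_corner_ring r_minus l_minus l_neg)
    then show "\<exists>y\<in>carrier (corner_ring R e). y \<oplus>\<^bsub>corner_ring R e\<^esub> x = \<zero>\<^bsub>corner_ring R e\<^esub>"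
      by auto
  qed (use e in \<open>auto simp: carrier_corner_ring a_ac l_distr r_distr\<close>)
  show "monoid (corner_ring R e)"
  proof (rule monoidI)
    fix x y assume "x \<in> carrier (corner_ring R e)" "y \<in> carrier (corner_ring R e)"
    then show "x \<otimes>\<^bsub>corner_ring R e\<^esub> y \<in> carrier (corner_ring R e)"
      using e by (auto simp: carrier_corner_ring m_assoc) (simp add: m_assoc[symmetric])
  qed (use e in \<open>auto simp: carrier_corner_ring m_assoc\<close>)
qed (use e in \<open>auto simp: carrier_corner_ring l_distr r_distr\<close>)

lemma finsum_corner_ring:
  assumes e: "e \<in> carrier R" "e \<otimes> e = e" and "finite A" "A \<subseteq> carrier (corner_ring R e)"
  shows "(\<Oplus>\<^bsub>corner_ring R e\<^esub>x\<in>A. x) = (\<Oplus>x\<in>A. x)"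
proof -
  interpret C: ring "corner_ring R e"
    using e by (rule ring_corner_ring)
  show ?thesis
    using assms(3,4)
  proof (induction A rule: finite_induct)
    case (insert a A)
    have "finsum (corner_ring R e) (\<lambda>x. x) (insert a A) = a \<oplus> finsum (corner_ring R e) (\<lambda>x. x) A"
      using insert by (subst C.finsum_insert) auto
    moreover have "finsum R (\<lambda>x. x) (insert a A) = a \<oplus> finsum R (\<lambda>x. x) A"
      using insert e by (subst finsum_insert) (auto simp: carrier_corner_ring)
    ultimately show ?case
      using insert by simp
  qed simp
qed

lemma idem_compl:
  assumes e: "e \<in> carrier R" "e \<otimes> e = e"
  shows "\<one> \<ominus> e \<in> carrier R" "(\<one> \<ominus> e) \<otimes> (\<one> \<ominus> e) = \<one> \<ominus> e"
    "e \<otimes> (\<one> \<ominus> e) = \<zero>" "(\<one> \<ominus> e) \<otimes> e = \<zero>" "e \<oplus> (\<one> \<ominus> e) = \<one>"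
proof -
  show c: "\<one> \<ominus> e \<in> carrier R"
    using e by simp
  show 0: "e \<otimes> (\<one> \<ominus> e) = \<zero>" "(\<one> \<ominus> e) \<otimes> e = \<zero>"
    using e by (simp_all add: minus_eq l_distr r_distr l_minus r_minus r_neg)
  show 1: "e \<oplus> (\<one> \<ominus> e) = \<one>"
    using e a_lcomm[of e \<one> "\<ominus> e"] by (simp add: minus_eq r_neg)
  have "(\<one> \<ominus> e) = (e \<oplus> (\<one> \<ominus> e)) \<otimes> (\<one> \<ominus> e)"
    using c 1 by simp
  also have "\<dots> = (\<one> \<ominus> e) \<otimes> (\<one> \<ominus> e)"
    using c e 0 by (simp add: l_distr)
  finally show "(\<one> \<ominus> e) \<otimes> (\<one> \<ominus> e) = \<one> \<ominus> e" ..
qed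

end

section \<open>Trivial decompositions\<close>

text \<open>Since the members are nonzero and orthogonal, they are distinct. So a set carries the same
  information as a family, and gluing two decompositions needs no renumbering.\<close>

definition trivial_decomposition :: "('a, 'm) ring_scheme \<Rightarrow> 'a set \<Rightarrow> bool" where
  "trivial_decomposition R E \<longleftrightarrow>
     finite E \<and> E \<subseteq> carrier R \<and> \<zero>\<^bsub>R\<^esub> \<notin> E \<and> (\<forall>x\<in>E. x \<otimes>\<^bsub>R\<^esub> x = x) \<and>
     (\<Oplus>\<^bsub>R\<^esub>x\<in>E. x) = \<one>\<^bsub>R\<^esub> \<and>
     (\<forall>x\<in>E. \<forall>y\<in>E. x \<noteq> y \<longrightarrow> x \<otimes>\<^bsub>R\<^esub> y = \<zero>\<^bsub>R\<^esub> \<and>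
        (\<forall>r\<in>carrier R. \<forall>s\<in>carrier R. x \<otimes>\<^bsub>R\<^esub> r \<otimes>\<^bsub>R\<^esub> y \<otimes>\<^bsub>R\<^esub> s \<otimes>\<^bsub>R\<^esub> x = \<zero>\<^bsub>R\<^esub>))"

context ring
begin

lemma trivial_decomposition_one: "\<one> \<noteq> \<zero> \<Longrightarrow> trivial_decomposition R {\<one>}"
  by (auto simp: trivial_decomposition_def)

text \<open>In a trivial decomposition of \<open>eRe\<close> the products \<open>x r y s x\<close> vanish even for \<open>r\<close> and \<open>s\<close> outside
  the corner, because \<open>x = xe = ex\<close> and \<open>y = eye\<close> allow \<open>r\<close> and \<open>s\<close> to be replaced by \<open>ere\<close> and \<open>ese\<close>.\<close>

lemma trivial_decomposition_corner:
  assumes e: "e \<in> carrier R" "e \<otimes> e = e"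
    and E: "trivial_decomposition (corner_ring R e) E"
    and x: "x \<in> E"
  shows "x \<in> carrier R" "e \<otimes> x = x" "x \<otimes> e = x"
    and "y \<in> E \<Longrightarrow> x \<noteq> y \<Longrightarrow> r \<in> carrier R \<Longrightarrow> s \<in> carrier R \<Longrightarrow>
      x \<otimes> r \<otimes> y \<otimes> s \<otimes> x = \<zero>"
proof -
  have *: "z \<in> carrier R \<and> e \<otimes> z = z \<and> z \<otimes> e = z" if "z \<in> E" for z
    using E that e by (auto simp: trivial_decomposition_def carrier_corner_ring)
  show xR: "x \<in> carrier R" "e \<otimes> x = x" "x \<otimes> e = x"
    using *[OF x] by auto
  assume y: "y \<in> E" "x \<noteq> y" and rs: "r \<in> carrier R" "s \<in> carrier R"
  have yR: "y \<in> carrier R" "e \<otimes> y = y" "y \<otimes> e = y"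
    using *[OF y(1)] by auto
  have C: "e \<otimes> t \<otimes> e \<in> carrier (corner_ring R e)" if "t \<in> carrier R" for t
    using that by (auto simp: corner_ring_def Peirce_pos_def)
  have "x \<otimes> (e \<otimes> r \<otimes> e) \<otimes> y \<otimes> (e \<otimes> s \<otimes> e) \<otimes> x = \<zero>"
    using E x y C rs unfolding trivial_decomposition_def by simp
  also have "x \<otimes> (e \<otimes> r \<otimes> e) \<otimes> y \<otimes> (e \<otimes> s \<otimes> e) \<otimes> x
    = (x \<otimes> e) \<otimes> r \<otimes> (e \<otimes> (y \<otimes> e)) \<otimes> s \<otimes> (e \<otimes> x)"
    using e rs xR(1) yR(1) by (simp add: m_assoc)
  finally show "x \<otimes> r \<otimes> y \<otimes> s \<otimes> x = \<zero>"
    by (simp add: xR yR)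
qed

text \<open>Going from \<open>eRe\<close> to the other corner and back passes through \<open>eRfRe\<close>, whatever the
  elements \<open>x \<in> eRe\<close> and \<open>y \<in> fR\<close> are.\<close>

lemma crossing_products_zero:
  assumes "e \<in> carrier R" "f \<in> carrier R" "x \<in> carrier R" "y \<in> carrier R"
      "r \<in> carrier R" "s \<in> carrier R"
    and x: "e \<otimes> x = x" "x \<otimes> e = x" and y: "f \<otimes> y = y"
    and ef: "\<forall>r\<in>carrier R. \<forall>s\<in>carrier R. e \<otimes> r \<otimes> f \<otimes> s \<otimes> e = \<zero>"
  shows "x \<otimes> r \<otimes> y \<otimes> s \<otimes> x = \<zero>"
proof -
  have "x \<otimes> r \<otimes> y \<otimes> s \<otimes> x = (x \<otimes> e) \<otimes> r \<otimes> (f \<otimes> y) \<otimes> s \<otimes> (e \<otimes> x)"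
    using x y by simp
  also have "\<dots> = x \<otimes> (e \<otimes> r \<otimes> f \<otimes> (y \<otimes> s) \<otimes> e) \<otimes> x"
    using assms(1-6) by (simp add: m_assoc)
  also have "\<dots> = \<zero>"
    using assms by simp
  finally show ?thesis .
qed

text \<open>The gluing principle. Distinct \<open>x\<close> and \<open>y\<close> in the union lie either in the same corner, where
  the hypothesis on that corner applies, or in different ones, where the two halves of Peirce
  triviality apply. The two parts are disjoint because an element common to both corners is zero,
  so the sizes add up.\<close>

lemma trivial_decomposition_Un:
  assumes e: "e \<in> Peirce_trivial_idems R"
    and E: "trivial_decomposition (corner_ring R e) E"
    and F: "trivial_decomposition (corner_ring R (\<one> \<ominus> e)) F"
  shows "trivial_decomposition R (E \<union> F)" "E \<inter> F = {}"
proof -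
  define f where "f = \<one> \<ominus> e"
  have eR: "e \<in> carrier R" "e \<otimes> e = e"
    and efe: "\<forall>r\<in>carrier R. \<forall>s\<in>carrier R. e \<otimes> r \<otimes> f \<otimes> s \<otimes> e = \<zero>"
    and fef: "\<forall>r\<in>carrier R. \<forall>s\<in>carrier R. f \<otimes> r \<otimes> e \<otimes> s \<otimes> f = \<zero>"
    using e by (auto simp: Peirce_trivial_idems_def f_def)
  have fR: "f \<in> carrier R" "f \<otimes> f = f" and ef: "e \<otimes> f = \<zero>" "f \<otimes> e = \<zero>" "e \<oplus> f = \<one>"
    using idem_compl[OF eR] by (auto simp: f_def)
  note F = F[folded f_def]
  note xE = trivial_decomposition_corner[OF eR E]
  note xF = trivial_decomposition_corner[OF fR F]
  have EF: "x \<otimes> y = \<zero>" "y \<otimes> x = \<zero>" if "x \<in> E" "y \<in> F" for x y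
  proof -
    have R: "x \<in> carrier R" "y \<in> carrier R"
      using xE(1) xF(1) that by auto
    have "x \<otimes> y = (x \<otimes> e) \<otimes> (f \<otimes> y)"
      using xE xF that by simp
    also have "\<dots> = x \<otimes> (e \<otimes> f) \<otimes> y"
      using R eR(1) fR(1) by (simp only: m_assoc m_closed)
    finally show "x \<otimes> y = \<zero>"
      using R ef by simp
    have "y \<otimes> x = (y \<otimes> f) \<otimes> (e \<otimes> x)"
      using xE xF that by simp
    also have "\<dots> = y \<otimes> (f \<otimes> e) \<otimes> x"
      using R eR(1) fR(1) by (simp only: m_assoc m_closed)
    finally show "y \<otimes> x = \<zero>"
      using R ef by simp
  qed
  show disj: "E \<inter> F = {}"
  proof (rule ccontr)
    assume "E \<inter> F \<noteq> {}"
    then obtain x where x: "x \<in> E" "x \<in> F" by blast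
    then have "x = x \<otimes> x"
      using E by (auto simp: trivial_decomposition_def)
    then have "x = \<zero>"
      using EF x by simp
    then show False
      using E x by (auto simp: trivial_decomposition_def)
  qed
  have fin: "finite E" "finite F" and sub: "E \<subseteq> carrier R" "F \<subseteq> carrier R"
    using E F xE(1) xF(1) by (auto simp: trivial_decomposition_def)
  have "(\<Oplus>x\<in>E. x) = e" "(\<Oplus>x\<in>F. x) = f"
    using E F finsum_corner_ring[OF eR, of E] finsum_corner_ring[OF fR, of F]
    unfolding trivial_decomposition_def by simp_all
  then have sum: "(\<Oplus>x\<in>E \<union> F. x) = \<one>"
    using finsum_Un_disjoint[of E F "\<lambda>x. x"] fin disj sub ef by (simp add: Pi_def subset_iff)
  have "x \<otimes> y = \<zero> \<and> (\<forall>r\<in>carrier R. \<forall>s\<in>carrier R. x \<otimes> r \<otimes> y \<otimes> s \<otimes> x = \<zero>)"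
    if xy: "x \<in> E \<union> F" "y \<in> E \<union> F" "x \<noteq> y" for x y
  proof -
    consider "x \<in> E" "y \<in> E" | "x \<in> F" "y \<in> F" | "x \<in> E" "y \<in> F" | "x \<in> F" "y \<in> E"
      using xy by blast
    then show ?thesis
    proof cases
      case 1
      then show ?thesis
        using xE(4) E xy(3) unfolding trivial_decomposition_def corner_ring_simps by blast
    next
      case 2
      then show ?thesis
        using xF(4) F xy(3) unfolding trivial_decomposition_def corner_ring_simps by blast
    next
      case 3
      then show ?thesis
        using EF xE(1-3) xF(1-3) crossing_products_zero[OF eR(1) fR(1) _ _ _ _ _ _ _ efe] by blast
    next
      case 4
      then show ?thesis
        using EF xE(1-3) xF(1-3) crossing_products_zero[OF fR(1) eR(1) _ _ _ _ _ _ _ fef] by blast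
    qed
  qed
  then have "\<forall>x\<in>E \<union> F. \<forall>y\<in>E \<union> F. x \<noteq> y \<longrightarrow> x \<otimes> y = \<zero> \<and>
      (\<forall>r\<in>carrier R. \<forall>s\<in>carrier R. x \<otimes> r \<otimes> y \<otimes> s \<otimes> x = \<zero>)"
    by blast
  moreover have "\<forall>x\<in>E \<union> F. x \<otimes> x = x" "\<zero> \<notin> E \<union> F"
    using E F unfolding trivial_decomposition_def corner_ring_simps by blast+
  moreover have "finite (E \<union> F)" "E \<union> F \<subseteq> carrier R"
    using fin sub by auto
  ultimately show "trivial_decomposition R (E \<union> F)"
    unfolding trivial_decomposition_def using sum by (intro conjI)
qed

lemma trivial_decomposition_glue:
  assumes e: "e \<in> Peirce_trivial_idems R"
    and "\<exists>E. card E = a \<and> trivial_decomposition (corner_ring R e) E"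
    and "\<exists>F. card F = b \<and> trivial_decomposition (corner_ring R (\<one> \<ominus> e)) F"
  shows "\<exists>E. card E = a + b \<and> trivial_decomposition R E"
proof -
  obtain E F where EF: "card E = a" "trivial_decomposition (corner_ring R e) E"
      "card F = b" "trivial_decomposition (corner_ring R (\<one> \<ominus> e)) F"
    using assms by blast
  then have "card (E \<union> F) = a + b"
    using trivial_decomposition_Un(2)[OF e] by (simp add: card_Un_disjoint trivial_decomposition_def)
  then show ?thesis
    using trivial_decomposition_Un(1)[OF e] EF by blast
qed

lemma Peirce_matrix_ring_of_trivial_decomposition:
  assumes E: "trivial_decomposition R E" and k: "card E = k" "1 < k"
  shows "\<exists>e. complete_orth_idems R k e \<and> Peirce_matrix_ring R k e \<in> \<T> k"
proof -
  have fin: "finite E" and sub: "E \<subseteq> carrier R" and sum: "(\<Oplus>x\<in>E. x) = \<one>"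
    using E by (auto simp: trivial_decomposition_def)
  obtain e where e: "bij_betw e {1..k} E"
    using finite_same_card_bij[of "{1..k}" E] fin k by auto
  have inj: "inj_on e {1..k}" and im: "E = e ` {1..k}"
    using e by (auto simp: bij_betw_def)
  have eE: "e i \<in> E" if "i \<in> {1..k}" for i
    using that im by blast
  have neq: "e i \<noteq> e j" if "i \<in> {1..k}" "j \<in> {1..k}" "i \<noteq> j" for i j
    using inj that by (auto dest: inj_onD)
  have "(\<lambda>x. x) \<in> e ` {1..k} \<rightarrow> carrier R"
    using sub im by auto
  then have "(\<Oplus>i\<in>{1..k}. e i) = \<one>"
    using finsum_reindex[of "\<lambda>x. x" e "{1..k}"] inj im sum by simp
  moreover have "e i \<otimes> e j = \<zero>" if "i \<in> {1..k}" "j \<in> {1..k}" "i \<noteq> j" for i j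
    using E eE neq[OF that] that unfolding trivial_decomposition_def by blast
  moreover have "e i \<in> carrier R \<and> e i \<otimes> e i = e i \<and> e i \<noteq> \<zero>" if "i \<in> {1..k}" for i
    using E eE[OF that] unfolding trivial_decomposition_def by (metis subsetD)
  ultimately have "complete_orth_idems R k e"
    by (simp add: complete_orth_idems_def)
  moreover have "x \<otimes> y = \<zero>"
    if ij: "i \<in> {1..k}" "j \<in> {1..k}" "i \<noteq> j"
      and x: "x \<in> Peirce_pos R (e i) (e j)" and y: "y \<in> Peirce_pos R (e j) (e i)" for i j x y
  proof -
    have eR: "e i \<in> carrier R" "e j \<in> carrier R" "e j \<otimes> e j = e j"
      and 0: "\<forall>r\<in>carrier R. \<forall>s\<in>carrier R. e i \<otimes> r \<otimes> e j \<otimes> s \<otimes> e i = \<zero>"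
      using E eE[OF ij(1)] eE[OF ij(2)] neq[OF ij] unfolding trivial_decomposition_def by blast+
    obtain r s where rs: "r \<in> carrier R" "s \<in> carrier R"
      and xy: "x = e i \<otimes> r \<otimes> e j" "y = e j \<otimes> s \<otimes> e i"
      using x y by (auto simp: Peirce_pos_def)
    have "x \<otimes> y = e i \<otimes> r \<otimes> (e j \<otimes> e j) \<otimes> s \<otimes> e i"
      using eR(1,2) rs by (simp add: xy m_assoc)
    then show ?thesis
      using 0 rs eR by simp
  qed
  then have "Peirce_matrix_ring R k e \<in> \<T> k"
    using k by (auto simp: trivial_product_rings_def Peirce_matrix_ring_def)
  ultimately show ?thesis
    by blast
qed

end

section \<open>Sizes of trivial decompositions\<close>

lemma n_Peirce_ring_pos: "n_Peirce_ring n R \<Longrightarrow> 1 \<le> n"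
  by (induction rule: n_Peirce_ring.induct) auto

lemma n_Peirce_ring_nontrivial: "n_Peirce_ring n R \<Longrightarrow> ring R \<Longrightarrow> \<one>\<^bsub>R\<^esub> \<noteq> \<zero>\<^bsub>R\<^esub>"
proof (induction rule: n_Peirce_ring.induct)
  case (split_Peirce n e R m)
  interpret ring R by fact
  have e: "e \<in> carrier R" "e \<otimes>\<^bsub>R\<^esub> e = e"
    using split_Peirce.hyps by (auto simp: Peirce_trivial_idems_def)
  then have "e \<noteq> \<zero>\<^bsub>R\<^esub>"
    using split_Peirce.IH(1) ring_corner_ring by simp
  then show ?case
    using e by (metis r_null r_one)
qed auto

text \<open>A size \<open>k \<ge> 2\<close> with \<open>k \<le> n = m + (n - m)\<close> can be distributed over the two corners with a
  positive share for each, so that the induction hypotheses apply to both.\<close>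

lemma n_Peirce_trivial_decomposition:
  assumes "n_Peirce_ring n R" "ring R" "1 \<le> k" "k \<le> n"
  shows "\<exists>E. card E = k \<and> trivial_decomposition R E"
  using assms
proof (induction arbitrary: k rule: n_Peirce_ring.induct)
  case (one_Peirce R)
  interpret ring R by fact
  show ?case
    using one_Peirce trivial_decomposition_one by (intro exI[of _ "{\<one>\<^bsub>R\<^esub>}"]) auto
next
  case (split_Peirce n e R m)
  interpret ring R by fact
  have e: "e \<in> carrier R" "e \<otimes>\<^bsub>R\<^esub> e = e"
    using split_Peirce.hyps by (auto simp: Peirce_trivial_idems_def)
  show ?case
  proof (cases "k = 1")
    case True
    have "\<one>\<^bsub>R\<^esub> \<noteq> \<zero>\<^bsub>R\<^esub>"
      using n_Peirce_ring.split_Peirce[OF split_Peirce.hyps] n_Peirce_ring_nontrivial ring_axioms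
      by blast
    then show ?thesis
      using True trivial_decomposition_one by (intro exI[of _ "{\<one>\<^bsub>R\<^esub>}"]) auto
  next
    case False
    define a where "a = min m (k - 1)"
    have a: "1 \<le> a" "a \<le> m" "1 \<le> k - a" "k - a \<le> n - m" "a + (k - a) = k"
      using False split_Peirce by (auto simp: a_def)
    have "\<exists>E. card E = a + (k - a) \<and> trivial_decomposition R E"
      using split_Peirce.IH a(1-4) ring_corner_ring e idem_compl[OF e] split_Peirce.hyps
      by (intro trivial_decomposition_glue[of e]) auto
    then show ?thesis
      using a by simp
  qed
qed

text \<open>The descent step. The failure of the Peirce condition is used twice: for \<open>n = 1\<close> it supplies a
  proper Peirce trivial idempotent, and for \<open>n = a + b\<close> it prevents the corners of that idempotent
  from being an \<open>a\<close>-Peirce and a \<open>b\<close>-Peirce ring.\<close>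

lemma (in ring) non_Peirce_corner:
  assumes "\<one> \<noteq> \<zero>" and non: "\<nexists>n. n_Peirce_ring n R"
  obtains e where "e \<in> Peirce_trivial_idems R" "e \<noteq> \<zero>" "\<one> \<ominus> e \<noteq> \<zero>"
    "(\<nexists>n. n_Peirce_ring n (corner_ring R e)) \<or> (\<nexists>n. n_Peirce_ring n (corner_ring R (\<one> \<ominus> e)))"
proof -
  have "{\<zero>, \<one>} \<subseteq> Peirce_trivial_idems R"
    by (auto simp: Peirce_trivial_idems_def minus_eq r_neg)
  moreover have "Peirce_trivial_idems R \<noteq> {\<zero>, \<one>}"
    using assms one_Peirce by metis
  ultimately obtain e where e: "e \<in> Peirce_trivial_idems R" "e \<noteq> \<zero>" "e \<noteq> \<one>"
    by blast
  then have "e \<in> carrier R" "e \<oplus> (\<one> \<ominus> e) = \<one>"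
    using idem_compl(5)[of e] by (auto simp: Peirce_trivial_idems_def)
  then have "\<one> \<ominus> e \<noteq> \<zero>"
    using e(3) by auto
  moreover have False
    if "n_Peirce_ring a (corner_ring R e)" "n_Peirce_ring b (corner_ring R (\<one> \<ominus> e))" for a b
  proof -
    have "n_Peirce_ring (a + b) R"
      using split_Peirce[OF _ e(1), of "a + b" a] that
        n_Peirce_ring_pos[OF that(1)] n_Peirce_ring_pos[OF that(2)] by simp
    then show False
      using non by blast
  qed
  ultimately show thesis
    using e(1,2) by (intro that[of e]) blast+
qed

lemma non_Peirce_trivial_decomposition:
  assumes "ring R" "\<one>\<^bsub>R\<^esub> \<noteq> \<zero>\<^bsub>R\<^esub>" "\<nexists>n. n_Peirce_ring n R"
  shows "\<exists>E. card E = Suc k \<and> trivial_decomposition R E"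
  using assms
proof (induction k arbitrary: R)
  case 0
  then show ?case
    using ring.trivial_decomposition_one by (intro exI[of _ "{\<one>\<^bsub>R\<^esub>}"]) auto
next
  case (Suc k)
  interpret ring R by fact
  obtain e where e: "e \<in> Peirce_trivial_idems R" "e \<noteq> \<zero>\<^bsub>R\<^esub>" "\<one>\<^bsub>R\<^esub> \<ominus>\<^bsub>R\<^esub> e \<noteq> \<zero>\<^bsub>R\<^esub>"
    and non: "(\<nexists>n. n_Peirce_ring n (corner_ring R e)) \<or>
      (\<nexists>n. n_Peirce_ring n (corner_ring R (\<one>\<^bsub>R\<^esub> \<ominus>\<^bsub>R\<^esub> e)))"
    using non_Peirce_corner Suc.prems by blast
  define f where "f = \<one>\<^bsub>R\<^esub> \<ominus>\<^bsub>R\<^esub> e"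
  have eR: "e \<in> carrier R" "e \<otimes>\<^bsub>R\<^esub> e = e"
    using e by (auto simp: Peirce_trivial_idems_def)
  have rings: "ring (corner_ring R e)" "ring (corner_ring R f)"
    using ring_corner_ring eR idem_compl[OF eR] by (auto simp: f_def)
  have one: "\<exists>E. card E = 1 \<and> trivial_decomposition (corner_ring R g) E"
    if "g = e \<or> g = f" for g
  proof (intro exI conjI)
    show "trivial_decomposition (corner_ring R g) {g}"
      using that e rings ring.trivial_decomposition_one[of "corner_ring R g"]
      by (auto simp: f_def)
  qed simp
  show ?case
    using non
  proof
    assume "\<nexists>n. n_Peirce_ring n (corner_ring R e)"
    then have "\<exists>E. card E = Suc k \<and> trivial_decomposition (corner_ring R e) E"
      using Suc.IH[of "corner_ring R e"] rings e by simp
    from trivial_decomposition_glue[OF e(1) this, of 1] show ?thesis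
      using one[of f] by (simp add: f_def)
  next
    assume "\<nexists>n. n_Peirce_ring n (corner_ring R (\<one>\<^bsub>R\<^esub> \<ominus>\<^bsub>R\<^esub> e))"
    then have "\<exists>E. card E = Suc k \<and> trivial_decomposition (corner_ring R f) E"
      using Suc.IH[of "corner_ring R f"] rings e by (simp add: f_def)
    from trivial_decomposition_glue[OF e(1), of 1, OF _ this[unfolded f_def]] show ?thesis
      using one[of e] by simp
  qed
qed

section \<open>The trichotomy\<close>

lemma (in ring) zero_ring_Peirce_matrix_ring:
  assumes 0: "\<one> = \<zero>" and "1 < k"
  shows "\<exists>e. complete_orth_idems R k e \<and> Peirce_matrix_ring R k e \<in> \<T> k"
proof (intro exI conjI)
  show "complete_orth_idems R k (\<lambda>_. \<zero>)"
    using 0 by (auto simp: complete_orth_idems_def)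
  show "Peirce_matrix_ring R k (\<lambda>_. \<zero>) \<in> \<T> k"
    using \<open>1 < k\<close> by (auto simp: trivial_product_rings_def Peirce_matrix_ring_def Peirce_pos_def)
qed

theorem theorem3p3:
  fixes R :: "('a, 'm) ring_scheme"
  assumes "ring R"
  shows "n_Peirce_ring 1 R \<or>
    (\<exists>n>1. n_Peirce_ring n R \<and>
       (\<forall>k. 1 < k \<and> k \<le> n \<longrightarrow>
          (\<exists>e. complete_orth_idems R k e \<and> Peirce_matrix_ring R k e \<in> \<T> k))) \<or>
    (\<forall>k>1. \<exists>e. complete_orth_idems R k e \<and> Peirce_matrix_ring R k e \<in> \<T> k)"
proof -
  interpret ring R by fact
  show ?thesis
  proof (cases "\<exists>n. n_Peirce_ring n R")
    case True
    then obtain n where n: "n_Peirce_ring n R" by blast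
    show ?thesis
    proof (cases "n = 1")
      case False
      then have "1 < n"
        using n_Peirce_ring_pos[OF n] by simp
      moreover have "\<exists>e. complete_orth_idems R k e \<and> Peirce_matrix_ring R k e \<in> \<T> k"
        if "1 < k \<and> k \<le> n" for k
        using n_Peirce_trivial_decomposition[OF n ring_axioms, of k] that
          Peirce_matrix_ring_of_trivial_decomposition by auto
      ultimately show ?thesis
        using n by blast
    qed (use n in simp)
  next
    case non: False
    have "\<exists>e. complete_orth_idems R k e \<and> Peirce_matrix_ring R k e \<in> \<T> k" if "1 < k" for k
    proof (cases "\<one>\<^bsub>R\<^esub> = \<zero>\<^bsub>R\<^esub>")
      case True
      then show ?thesis
        using that zero_ring_Peirce_matrix_ring by blast
    next
      case False
      obtain E where "card E = Suc (k - 1)" "trivial_decomposition R E"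
        using non_Peirce_trivial_decomposition[OF ring_axioms False non] by blast
      then show ?thesis
        using that Peirce_matrix_ring_of_trivial_decomposition by auto
    qed
    then show ?thesis
      by blast
  qed
qed

end
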